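(* Let $\mathcal H$ be a real Hilbert space, $C\subseteq\mathcal H$ nonempty, closed and convex, and $F:\mathcal H\to\mathcal H$. Assume that $SOL(C,F)\neq\emptyset$, that $F$ is monotone on $\mathcal H$ ($\langle F(x)-F(y),x-y\rangle\ge 0$ for all $x,y\in\mathcal H$), and that $F$ is Lipschitz continuous on $\mathcal H$ with some constant $L>0$. Assume that the sequences $\{\alpha_k^{(i)}\}_{k=0}^\infty\subset[0,1]$, $i=1,2$, satisfy $$\sum_{k=0}^\infty\alpha_k^{(i)}\|x^k-x^{k-1}\|<+\infty,\qquad i=1,2,$$ and $$\alpha_k^{(1)}\|x^k-x^{k-1}\|\le\mu\|x^k-y^k\|,$$ where $\mu\in[0,1-\nu)$. Then any sequence $\{x^k\}_{k=0}^\infty$ generated by the inertial PC-algorithm II (iPC II-1) described in the context converges weakly to a point of $SOL(C,F)$, i.e. to a solution of the variational inequality problem.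
   Context: The variational inequality problem is: find $x^*\in C$ with $\langle F(x^* ),x-x^*\rangle\ge 0$ for all $x\in C$; its solution set is $SOL(C,F)$. $P_C$ denotes the metric projection onto $C$. Inertial PC-algorithm II (iPC II-1): fix $\nu\in(0,1)$, $\gamma\in(0,2)$ and starting points $x^{-1},x^0\in\mathcal H$. Given $x^{k-1},x^k$, set $$y^k=P_C\big(x^k-\beta_kF(x^k)+\alpha_k^{(1)}(x^k-x^{k-1})\big),$$ where $\beta_k>0$ is selected to satisfy $\beta_k\|F(x^k)-F(y^k)\|\le\nu\|x^k-y^k\|$. Define $$d(x^k,y^k)=(x^k-y^k)-\beta_k(F(x^k)-F(y^k))+\alpha_k^{(1)}(x^k-x^{k-1}),\qquad \rho_k=\frac{\langle x^k-y^k,d(x^k,y^k)\rangle}{\|d(x^k,y^k)\|^2},$$ $$x^{k+1}=P_C\big(x^k-\gamma\beta_k\rho_kF(y^k)+\alpha_k^{(2)}(x^k-x^{k-1})\big).$$ It is understood that $d(x^k,y^k)\ne0$ for all $k$, so that $\rho_k$ is defined.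
   Formalization: The step sizes β_k are additionally assumed bounded below by a positive constant; without this the claim fails, e.g. C=H=ℝ, F=id, ν=1/2, γ=1, α_k^{(i)}=0, β_k=1/(k+2)², x^0=2 gives x^k→1, which is not a solution. *)

theory Defs
  imports "HOL-Analysis.Analysis"
begin

definition VI_SOL :: "'a::real_inner set \<Rightarrow> ('a \<Rightarrow> 'a) \<Rightarrow> 'a set" where
  "VI_SOL C F = {p \<in> C. \<forall>x\<in>C. inner (F p) (x - p) \<ge> 0}"

definition monotone_operator :: "('a::real_inner \<Rightarrow> 'a) \<Rightarrow> bool" where
  "monotone_operator F \<longleftrightarrow> (\<forall>x y. inner (F x - F y) (x - y) \<ge> 0)"

(* Same defining term as closest_point, whose type requires heine_borel and hence
   excludes infinite-dimensional Hilbert spaces. For nonempty closed convex C in a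
   Hilbert space the selected point exists and is unique. *)
definition metric_proj :: "'a::real_inner set \<Rightarrow> 'a \<Rightarrow> 'a" where
  "metric_proj C a = (SOME p. p \<in> C \<and> (\<forall>q\<in>C. dist a p \<le> dist a q))"

definition weakly_converges :: "(nat \<Rightarrow> 'a::real_inner) \<Rightarrow> 'a \<Rightarrow> bool" where
  "weakly_converges u p \<longleftrightarrow> (\<forall>z. (\<lambda>k. inner (u k) z) \<longlonglongrightarrow> inner p z)"

(* In the next three definitions x', x, y stand for x^{k-1}, x^k, y^k. *)

definition iPC_d :: "('a::real_inner \<Rightarrow> 'a) \<Rightarrow> real \<Rightarrow> real \<Rightarrow> 'a \<Rightarrow> 'a \<Rightarrow> 'a \<Rightarrow> 'a" where
  "iPC_d F b a1 x' x y = (x - y) - b *\<^sub>R (F x - F y) + a1 *\<^sub>R (x - x')"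

definition iPC_rho :: "('a::real_inner \<Rightarrow> 'a) \<Rightarrow> real \<Rightarrow> real \<Rightarrow> 'a \<Rightarrow> 'a \<Rightarrow> 'a \<Rightarrow> real" where
  "iPC_rho F b a1 x' x y =
     inner (x - y) (iPC_d F b a1 x' x y) / (norm (iPC_d F b a1 x' x y))\<^sup>2"

definition iPC_II_step ::
  "'a::real_inner set \<Rightarrow> ('a \<Rightarrow> 'a) \<Rightarrow> real \<Rightarrow> real \<Rightarrow> real \<Rightarrow> real \<Rightarrow> real \<Rightarrow> 'a \<Rightarrow> 'a \<Rightarrow> 'a \<Rightarrow> 'a \<Rightarrow> bool" where
  "iPC_II_step C F \<nu> \<gamma> b a1 a2 x' x y xnext \<longleftrightarrow>
     y = metric_proj C (x - b *\<^sub>R F x + a1 *\<^sub>R (x - x')) \<and>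
     b > 0 \<and>
     b * norm (F x - F y) \<le> \<nu> * norm (x - y) \<and>
     iPC_d F b a1 x' x y \<noteq> 0 \<and>
     xnext = metric_proj C (x - (\<gamma> * b * iPC_rho F b a1 x' x y) *\<^sub>R F y + a2 *\<^sub>R (x - x'))"

(* The iterates are indexed by int so that x (-1) and x 0 are the two starting points;
   values of x below -1 are irrelevant. *)
definition iPC_II ::
  "'a::real_inner set \<Rightarrow> ('a \<Rightarrow> 'a) \<Rightarrow> real \<Rightarrow> real \<Rightarrow> (nat \<Rightarrow> real) \<Rightarrow> (nat \<Rightarrow> real) \<Rightarrow> (nat \<Rightarrow> real)
   \<Rightarrow> (int \<Rightarrow> 'a) \<Rightarrow> (nat \<Rightarrow> 'a) \<Rightarrow> bool" where
  "iPC_II C F \<nu> \<gamma> \<beta> \<alpha>1 \<alpha>2 x y \<longleftrightarrow>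
     (\<forall>k. iPC_II_step C F \<nu> \<gamma> (\<beta> k) (\<alpha>1 k) (\<alpha>2 k)
            (x (int k - 1)) (x (int k)) (y k) (x (int k + 1)))"

end

theory Submission
  imports Defs
begin

text \<open>
  The iterates are quasi-Fejer monotone with respect to the solution set. Write
  \<open>d\<close> and \<open>\<rho>\<close> for the direction and the step factor of one iteration, and \<open>e\<close>
  for the inertial term of the corrector. Testing the obtuse-angle inequality of the
  corrector projection at a solution \<open>p\<close>, and that of the predictor projection at the new iterate
  \<open>xn\<close>, and completing a square gives (lemma \<open>iPC_II_fejer_step\<close>)

    \<open>\<parallel>xn - p\<parallel>\<^sup>2 \<le> \<parallel>x - p\<parallel>\<^sup>2 - \<gamma> (2 - \<gamma>) \<rho> \<langle>x - y, d\<rangle> + 2 \<parallel>e\<parallel> \<parallel>xn - p\<parallel>\<close>.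

  The condition on \<open>\<beta>\<close> and the bound on the first inertial term by \<open>\<mu> \<parallel>x - y\<parallel>\<close>
  with \<open>\<mu> < 1 - \<nu>\<close> make \<open>\<rho> \<langle>x - y, d\<rangle>\<close> at least a positive multiple of
  \<open>\<parallel>x - y\<parallel>\<^sup>2\<close> (lemma \<open>iPC_gain_lower\<close>). Dropping this gain,
  \<open>\<parallel>x - p\<parallel>\<close> grows by at most the summable amount \<open>2 \<parallel>e\<parallel>\<close> per step, so it converges
  (lemma \<open>quasi_fejer_convergent\<close>); keeping it, \<open>\<parallel>x - y\<parallel>\<close> tends to zero. Since the step sizes
  stay away from zero, every weak cluster point of the iterates then satisfies Minty's form of
  the variational inequality and so is a solution (lemma \<open>weak_cluster_point_in_VI_SOL\<close>).
  Opial's lemma turns these two facts into weak convergence of the whole sequence.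

  Weak cluster points are limits along filters finer than the given one. In this form
  weak compactness of balls needs only Tychonoff's theorem for the functionals
  \<open>z \<mapsto> \<langle>u, z\<rangle>\<close> and the Riesz representation of the limit functional, with no extraction of
  subsequences and no separability.
\<close>

section \<open>Minimising a quadratic over a closed convex set\<close>

lemma nonneg_of_small_perturbation:
  fixes A B :: real
  assumes "\<And>t. 0 < t \<Longrightarrow> t \<le> 1 \<Longrightarrow> 0 \<le> A + t * B"
  shows "0 \<le> A"
proof (rule tendsto_lowerbound)
  show "((\<lambda>t. A + t * B) \<longlongrightarrow> A) (at_right 0)"
    by (auto intro!: tendsto_eq_intros)
  show "\<forall>\<^sub>F t in at_right 0. 0 \<le> A + t * B"
    using assms by (auto simp: eventually_at_right[of 0 1] intro!: exI[of _ 1])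
qed simp

text \<open>
  The point \<open>p\<close> minimises \<open>\<parallel>z\<parallel>\<^sup>2 - 2 l z\<close> over \<open>C\<close>: by the parallelogram law a minimising
  sequence is Cauchy, and the claim is the first-order optimality condition. The case
  \<open>C = UNIV\<close> is the Riesz representation of \<open>l\<close>, and the case \<open>l = inner a\<close> is the
  metric projection of \<open>a\<close>.
\<close>
lemma quadratic_minimiser_exists:
  fixes C :: "'a::{real_inner, complete_space} set" and l :: "'a \<Rightarrow> real"
  assumes C: "C \<noteq> {}" "closed C" "convex C" and l: "bounded_linear l"
  shows "\<exists>p\<in>C. \<forall>q\<in>C. l (q - p) \<le> inner p (q - p)"
proof -
  interpret l: bounded_linear l by (fact l)
  define J where "J z = (norm z)\<^sup>2 - 2 * l z" for z
  obtain K where K: "\<And>z. norm (l z) \<le> norm z * K"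
    using l.bounded by blast
  have J_below: "- (K\<^sup>2) \<le> J z" for z
  proof -
    have "l z \<le> norm z * K" using K[of z] by simp
    moreover have "0 \<le> (norm z - K)\<^sup>2" by simp
    ultimately show ?thesis
      unfolding J_def power2_diff by linarith
  qed
  then have bdd: "bdd_below (J ` C)" by (auto intro!: bdd_belowI)
  define m where "m = Inf (J ` C)"
  have m_le: "m \<le> J z" if "z \<in> C" for z
    unfolding m_def using that bdd by (auto intro: cInf_lower)
  have "\<exists>u\<in>C. J u < m + 1 / real (Suc n)" for n
    using cInf_lessD[of "J ` C" "m + 1 / real (Suc n)"] C(1) by (auto simp: m_def)
  then obtain u where uC: "\<And>n. u n \<in> C" and u: "\<And>n. J (u n) < m + 1 / real (Suc n)"
    by metis
  \<comment> \<open>the parallelogram law, with the value at the midpoint bounded below by \<open>m\<close>\<close>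
  have par: "(norm (v - w))\<^sup>2 \<le> 2 * (J v - m) + 2 * (J w - m)" if "v \<in> C" "w \<in> C" for v w
  proof -
    have "midpoint v w \<in> C"
      using convexD[OF C(3) that, of "1/2" "1/2"] by (simp add: midpoint_def scaleR_add_right)
    moreover have mid: "norm (midpoint v w) = norm (v + w) / 2" "l (midpoint v w) = (l v + l w) / 2"
      by (simp_all add: midpoint_def l.scaleR l.add del: scaleR_add_right)
    ultimately have "4 * m \<le> 4 * J (midpoint v w)" using m_le by simp
    also have "\<dots> = (norm (v + w))\<^sup>2 - 4 * (l v + l w)"
      unfolding J_def mid(1) mid(2) by (simp add: power_divide add_divide_distrib)
    also have "\<dots> = 2 * J v + 2 * J w - (norm (v - w))\<^sup>2"
      by (simp add: J_def power2_norm_eq_inner inner_simps inner_commute algebra_simps)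
    finally show ?thesis by simp
  qed
  have "Cauchy u"
  proof (rule metric_CauchyI)
    fix e :: real assume "0 < e"
    then obtain N where N: "inverse (real (Suc N)) < e\<^sup>2 / 4"
      using reals_Archimedean[of "e\<^sup>2 / 4"] by auto
    have gap: "J (u n) - m < e\<^sup>2 / 4" if "N \<le> n" for n
    proof -
      have "1 / real (Suc n) \<le> inverse (real (Suc N))"
        using that by (simp add: field_simps)
      with N u[of n] show ?thesis by linarith
    qed
    have "dist (u i) (u j) < e" if "N \<le> i" "N \<le> j" for i j
    proof (rule power2_less_imp_less)
      show "(dist (u i) (u j))\<^sup>2 < e\<^sup>2"
        using par[OF uC uC, of i j] gap[OF that(1)] gap[OF that(2)] by (simp add: dist_norm)
    qed (use \<open>0 < e\<close> in simp)
    then show "\<exists>N. \<forall>i\<ge>N. \<forall>j\<ge>N. dist (u i) (u j) < e" by blast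
  qed
  then obtain p where p: "u \<longlonglongrightarrow> p"
    using Cauchy_convergent convergent_def by blast
  have pC: "p \<in> C" using closed_sequentially[OF C(2)] uC p by blast
  have "J p \<le> m"
  proof (rule tendsto_le[OF sequentially_bot])
    show "(\<lambda>n. J (u n)) \<longlonglongrightarrow> J p"
      unfolding J_def by (intro tendsto_intros l.tendsto p)
    show "(\<lambda>n. m + 1 / real (Suc n)) \<longlonglongrightarrow> m"
      using tendsto_add[OF tendsto_const LIMSEQ_Suc[OF lim_1_over_n], of m] by simp
    show "\<forall>\<^sub>F n in sequentially. J (u n) \<le> m + 1 / real (Suc n)"
      using u by (auto intro!: always_eventually less_imp_le)
  qed
  have "l (q - p) \<le> inner p (q - p)" if q: "q \<in> C" for q
  proof -
    have "0 \<le> 2 * (inner p (q - p) - l (q - p)) + t * (norm (q - p))\<^sup>2"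
      if t: "0 < t" "t \<le> 1" for t
    proof -
      have "p + t *\<^sub>R (q - p) = (1 - t) *\<^sub>R p + t *\<^sub>R q" by (simp add: algebra_simps)
      then have "p + t *\<^sub>R (q - p) \<in> C"
        using convexD[OF C(3) pC q, of "1 - t" t] t by simp
      then have "J p \<le> J (p + t *\<^sub>R (q - p))" using m_le \<open>J p \<le> m\<close> by fastforce
      moreover have "J (p + t *\<^sub>R h) = J p + t * (2 * (inner p h - l h) + t * (norm h)\<^sup>2)" for h
        unfolding J_def power2_norm_eq_inner
        by (simp add: l.add l.scaleR inner_add_left inner_add_right inner_commute[of h p]
            algebra_simps)
      ultimately have "0 \<le> t * (2 * (inner p (q - p) - l (q - p)) + t * (norm (q - p))\<^sup>2)"
        by simp
      with t(1) show ?thesis by (simp add: zero_le_mult_iff)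
    qed
    from nonneg_of_small_perturbation[OF this] show ?thesis by simp
  qed
  with pC show ?thesis by blast
qed

lemma riesz_representation:
  fixes l :: "'a::{real_inner, complete_space} \<Rightarrow> real"
  assumes "bounded_linear l"
  shows "\<exists>p. \<forall>z. l z = inner p z"
proof -
  interpret l: bounded_linear l by (fact assms)
  obtain p where p: "\<And>q. l (q - p) \<le> inner p (q - p)"
    using quadratic_minimiser_exists[of UNIV l] assms by auto
  have "l z = inner p z" for z
    using p[of "p + z"] p[of "p - z"] l.scaleR[of "-1" z] by simp
  then show ?thesis by blast
qed

text \<open>
  A point with the obtuse-angle property satisfies a Pythagorean inequality, hence is the unique
  nearest point of \<open>C\<close> and therefore the one that the choice operator selects.
\<close>
lemma
  fixes C :: "'a::{real_inner, complete_space} set"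
  assumes C: "C \<noteq> {}" "closed C" "convex C"
  shows metric_proj_in: "metric_proj C a \<in> C"
    and metric_proj_obtuse: "q \<in> C \<Longrightarrow> inner (a - metric_proj C a) (q - metric_proj C a) \<le> 0"
proof -
  obtain p where pC: "p \<in> C" and p: "\<And>q. q \<in> C \<Longrightarrow> inner (a - p) (q - p) \<le> 0"
    using quadratic_minimiser_exists[OF C bounded_linear_inner_right[of a]]
    by (auto simp: inner_diff_left)
  have pyth: "(dist a p)\<^sup>2 + (dist q p)\<^sup>2 \<le> (dist a q)\<^sup>2" if "q \<in> C" for q
    using p[OF that] by (simp add: dist_norm power2_norm_eq_inner inner_simps inner_commute)
  have "metric_proj C a = p" unfolding metric_proj_def
  proof (rule some_equality)
    have "dist a p \<le> dist a q" if "q \<in> C" for q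
      by (rule power2_le_imp_le) (use pyth[OF that] zero_le_power2[of "dist q p"] in linarith, simp)
    with pC show "p \<in> C \<and> (\<forall>q\<in>C. dist a p \<le> dist a q)" by blast
  next
    fix q assume q: "q \<in> C \<and> (\<forall>r\<in>C. dist a q \<le> dist a r)"
    then have "(dist a q)\<^sup>2 \<le> (dist a p)\<^sup>2" using pC by (intro power_mono) auto
    then have "(dist q p)\<^sup>2 \<le> 0" using pyth[of q] q by linarith
    then show "q = p" by simp
  qed
  with pC p show "metric_proj C a \<in> C"
    and "q \<in> C \<Longrightarrow> inner (a - metric_proj C a) (q - metric_proj C a) \<le> 0"
    by simp_all
qed

section \<open>Weak cluster points and Opial's lemma\<close>

text \<open>
  Weak compactness of balls. The functionals \<open>inner (u k)\<close> lie in a product of compact intervals,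
  so by Tychonoff they have a pointwise cluster point \<open>f\<close>. Limits along the filter \<open>H\<close> that
  realises it pass linearity and the norm bound on to \<open>f\<close>, which is then represented by a vector.
\<close>
lemma bounded_weak_cluster_point:
  fixes u :: "'b \<Rightarrow> 'a::{real_inner, complete_space}"
  assumes bnd: "\<And>k. norm (u k) \<le> M" and "G \<noteq> bot"
  shows "\<exists>H q. H \<le> G \<and> H \<noteq> bot \<and> (\<forall>z. ((\<lambda>k. inner (u k) z) \<longlongrightarrow> inner q z) H)"
proof -
  define U where "U k = (\<lambda>z. inner (u k) z)" for k
  define S where "S = PiE UNIV (\<lambda>z::'a. {- (M * norm z) .. M * norm z})"
  have bound: "\<bar>inner (u k) z\<bar> \<le> M * norm z" for k z
    using Cauchy_Schwarz_ineq2[of "u k" z] mult_right_mono[OF bnd[of k] norm_ge_zero[of z]]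
    by linarith
  have "compact S"
    using compactin_PiE[of "\<lambda>_. euclidean" UNIV "\<lambda>z. {- (M * norm z) .. M * norm z}"]
    by (simp add: S_def euclidean_product_topology)
  moreover have "U k \<in> S" for k
    using bound[of k] by (auto simp: U_def S_def abs_le_iff minus_le_iff)
  moreover have "filtermap U G \<noteq> bot" using \<open>G \<noteq> bot\<close> by (simp add: filtermap_bot_iff)
  ultimately obtain f where f: "inf (nhds f) (filtermap U G) \<noteq> bot"
    unfolding compact_filter by (auto simp: eventually_filtermap)
  define H where "H = inf G (filtercomap U (nhds f))"
  have HG: "H \<le> G" by (simp add: H_def)
  have Hbot: "H \<noteq> bot"
  proof
    assume "H = bot"
    then obtain P Q where P: "eventually P G" and Q: "eventually Q (nhds f)"
      and PQ: "\<And>k. P k \<Longrightarrow> Q (U k) \<Longrightarrow> False"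
      by (auto simp: H_def eventually_inf eventually_filtercomap simp flip: eventually_False)
    have "eventually (\<lambda>g. \<not> Q g) (filtermap U G)"
      unfolding eventually_filtermap using P by eventually_elim (use PQ in blast)
    with Q have "eventually (\<lambda>_. False) (inf (nhds f) (filtermap U G))"
      unfolding eventually_inf by blast
    with f show False by (simp add: eventually_False)
  qed
  have lim: "((\<lambda>k. inner (u k) z) \<longlongrightarrow> f z) H" for z
  proof -
    have U: "filterlim U (nhds f) H"
      unfolding H_def by (rule filterlim_mono[OF filterlim_filtercomap]) auto
    show ?thesis
      using continuous_on_tendsto_compose[OF continuous_on_product_coordinates[of z] U]
      by (simp add: U_def)
  qed
  have "bounded_linear f"
  proof (rule bounded_linear_intro)
    show "f (z + w) = f z + f w" for z w
      using tendsto_unique[OF Hbot lim[of "z + w"]] tendsto_add[OF lim[of z] lim[of w]]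
      by (simp add: inner_add_right)
    show "f (r *\<^sub>R z) = r *\<^sub>R f z" for r z
      using tendsto_unique[OF Hbot lim[of "r *\<^sub>R z"]] tendsto_mult_left[OF lim[of z], of r]
      by simp
    show "norm (f z) \<le> norm z * M" for z
      using tendsto_upperbound[OF tendsto_norm[OF lim[of z]] _ Hbot, of "norm z * M"] bound
      by (simp add: mult.commute)
  qed
  then obtain q where "\<And>z. f z = inner q z" using riesz_representation by blast
  with lim have "\<forall>z. ((\<lambda>k. inner (u k) z) \<longlongrightarrow> inner q z) H" by simp
  with HG Hbot show ?thesis by blast
qed

text \<open>
  Opial's lemma. The inner product of \<open>u k\<close> with a difference of two points of \<open>S\<close> is a
  combination of squared distances to these points, so it converges. Two weak cluster points \<open>q\<close>
  and \<open>q'\<close>, both in \<open>S\<close>, hence have the same inner product with \<open>q - q'\<close> and coincide. A failure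
  of weak convergence would produce a second cluster point.
\<close>
lemma opial:
  fixes u :: "nat \<Rightarrow> 'a::{real_inner, complete_space}"
  assumes "S \<noteq> {}" and conv: "\<And>p. p \<in> S \<Longrightarrow> convergent (\<lambda>k. norm (u k - p))"
    and cluster: "\<And>G q. G \<le> sequentially \<Longrightarrow> G \<noteq> bot \<Longrightarrow>
      (\<And>z. ((\<lambda>k. inner (u k) z) \<longlongrightarrow> inner q z) G) \<Longrightarrow> q \<in> S"
  shows "\<exists>p\<in>S. weakly_converges u p"
proof -
  obtain p0 where p0: "p0 \<in> S" using \<open>S \<noteq> {}\<close> by blast
  obtain M where "\<And>k. norm (norm (u k - p0)) \<le> M"
    using convergent_imp_Bseq[OF conv[OF p0]] unfolding Bseq_def by blast
  then have bnd: "norm (u k) \<le> M + norm p0" for k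
    using norm_triangle_ineq[of "u k - p0" p0] by (simp add: add_increasing2 order_trans)
  note sub = bounded_weak_cluster_point[of u, OF bnd]
  obtain G q where G: "G \<le> sequentially" "G \<noteq> bot"
    and q: "\<And>z. ((\<lambda>k. inner (u k) z) \<longlongrightarrow> inner q z) G"
    using sub[OF sequentially_bot] by blast
  have qS: "q \<in> S" using cluster[OF G] q by blast
  have uniq: "q' = q" if H: "H \<le> sequentially" "H \<noteq> bot"
    and q': "\<And>z. ((\<lambda>k. inner (u k) z) \<longlongrightarrow> inner q' z) H" for H q'
  proof -
    have q'S: "q' \<in> S" using cluster[OF H] q' by blast
    obtain a b where a: "(\<lambda>k. norm (u k - q)) \<longlonglongrightarrow> a" and b: "(\<lambda>k. norm (u k - q')) \<longlonglongrightarrow> b"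
      using conv[OF qS] conv[OF q'S] unfolding convergent_def by blast
    define c where "c = (b\<^sup>2 - a\<^sup>2 + inner q q - inner q' q') / 2"
    have "(\<lambda>k. ((norm (u k - q'))\<^sup>2 - (norm (u k - q))\<^sup>2 + inner q q - inner q' q') / 2) \<longlonglongrightarrow> c"
      unfolding c_def by (intro tendsto_intros a b) simp
    moreover have "((norm (u k - q'))\<^sup>2 - (norm (u k - q))\<^sup>2 + inner q q - inner q' q') / 2
        = inner (u k) (q - q')" for k
      by (simp add: power2_norm_eq_inner inner_simps inner_commute)
    ultimately have lim: "(\<lambda>k. inner (u k) (q - q')) \<longlonglongrightarrow> c" by simp
    have "inner q (q - q') = c"
      using tendsto_unique[OF G(2) q tendsto_mono[OF G(1) lim]] .
    moreover have "inner q' (q - q') = c"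
      using tendsto_unique[OF H(2) q' tendsto_mono[OF H(1) lim]] .
    ultimately have "inner (q - q') (q - q') = 0" by (simp add: inner_diff_left)
    then show ?thesis by simp
  qed
  have "(\<lambda>k. inner (u k) z) \<longlonglongrightarrow> inner q z" for z
  proof (rule ccontr)
    assume "\<not> (\<lambda>k. inner (u k) z) \<longlonglongrightarrow> inner q z"
    then obtain A where A: "open A" "inner q z \<in> A"
      and nev: "\<not> eventually (\<lambda>k. inner (u k) z \<in> A) sequentially"
      unfolding tendsto_def by blast
    \<comment> \<open>restricting to the indices outside \<open>A\<close> gives a proper filter, and by compactness a cluster
      point along it\<close>
    define E where "E = inf sequentially (principal {k. inner (u k) z \<notin> A})"
    have "E \<noteq> bot"
      using nev by (simp add: E_def trivial_limit_def eventually_inf_principal)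
    then obtain H q' where H: "H \<le> E" "H \<noteq> bot"
      and q': "\<And>w. ((\<lambda>k. inner (u k) w) \<longlongrightarrow> inner q' w) H"
      using sub by blast
    have "H \<le> sequentially" using H(1) by (simp add: E_def)
    then have "q' = q" using uniq H(2) q' by blast
    then have "eventually (\<lambda>k. inner (u k) z \<in> A) H"
      using topological_tendstoD[OF q'[of z] A(1)] A(2) by simp
    moreover have "eventually (\<lambda>k. inner (u k) z \<notin> A) H"
      using H(1) by (simp add: E_def le_principal)
    ultimately have "eventually (\<lambda>_. False) H" by eventually_elim simp
    with H(2) show False by (simp add: eventually_False)
  qed
  with qS show ?thesis unfolding weakly_converges_def by blast
qed

section \<open>Variational inequalities\<close>

text \<open>
  Minty's lemma: test the inequality at \<open>q + t (z - q)\<close>, divide by \<open>t\<close> and let \<open>t\<close> tend to zero.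
\<close>
lemma minty:
  fixes F :: "'a::real_inner \<Rightarrow> 'a"
  assumes "convex C" "continuous_on UNIV F" "q \<in> C"
    and M: "\<And>z. z \<in> C \<Longrightarrow> 0 \<le> inner (F z) (z - q)"
  shows "q \<in> VI_SOL C F"
  unfolding VI_SOL_def
proof (intro CollectI conjI ballI)
  fix z assume z: "z \<in> C"
  show "0 \<le> inner (F q) (z - q)"
  proof (rule tendsto_lowerbound)
    have cont: "isCont F q" using assms(2) by (simp add: continuous_on_eq_continuous_at)
    have "((\<lambda>t. q + t *\<^sub>R (z - q)) \<longlongrightarrow> q) (at_right 0)"
      by (auto intro!: tendsto_eq_intros)
    then show "((\<lambda>t. inner (F (q + t *\<^sub>R (z - q))) (z - q)) \<longlongrightarrow> inner (F q) (z - q)) (at_right 0)"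
      by (intro tendsto_inner tendsto_const isCont_tendsto_compose[OF cont])
    have "0 \<le> inner (F (q + t *\<^sub>R (z - q))) (z - q)" if t: "0 < t" "t < 1" for t
    proof -
      have "q + t *\<^sub>R (z - q) = (1 - t) *\<^sub>R q + t *\<^sub>R z" by (simp add: algebra_simps)
      then have "q + t *\<^sub>R (z - q) \<in> C"
        using convexD[OF assms(1,3) z, of "1 - t" t] t by simp
      from M[OF this] t(1) show ?thesis by (simp add: zero_le_mult_iff)
    qed
    then show "\<forall>\<^sub>F t in at_right 0. 0 \<le> inner (F (q + t *\<^sub>R (z - q))) (z - q)"
      by (auto simp: eventually_at_right[of 0 1] intro!: exI[of _ 1])
  qed simp
qed fact

text \<open>
  The projection \<open>p\<close> of the weak limit \<open>q\<close> makes an obtuse angle with every member of the sequence;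
  in the limit this reads \<open>\<parallel>q - p\<parallel>\<^sup>2 \<le> 0\<close>.
\<close>
lemma weak_limit_in_convex:
  fixes C :: "'a::{real_inner, complete_space} set"
  assumes C: "closed C" "convex C" and yC: "\<And>k. y k \<in> C" and "G \<noteq> bot"
    and lim: "\<And>z. ((\<lambda>k. inner (y k) z) \<longlongrightarrow> inner q z) G"
  shows "q \<in> C"
proof -
  have ne: "C \<noteq> {}" using yC by blast
  define p where "p = metric_proj C q"
  have "((\<lambda>k. inner (q - p) (y k - p)) \<longlongrightarrow> inner (q - p) (q - p)) G"
    using tendsto_diff[OF lim[of "q - p"] tendsto_const[of "inner p (q - p)"]]
    by (simp add: inner_diff_right inner_commute)
  then have "inner (q - p) (q - p) \<le> 0"
    by (rule tendsto_upperbound)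
      (use metric_proj_obtuse[OF ne C yC, of q] \<open>G \<noteq> bot\<close> in \<open>auto simp: p_def\<close>)
  then have "q = p"
    using inner_ge_zero[of "q - p"] by (simp add: order_antisym)
  then show ?thesis using metric_proj_in[OF ne C] by (metis p_def)
qed

text \<open>
  The hypothesis on \<open>r\<close> says that \<open>y k\<close> satisfies, up to the error \<open>r k / b k\<close>, the variational
  inequality for the constant operator with value \<open>F (x k)\<close>. Monotonicity replaces the varying
  value \<open>F (x k)\<close> by the fixed value \<open>F z\<close>, against which the weak limit can be taken. The errors
  vanish because \<open>b\<close> is bounded away from zero and \<open>F\<close>, being Lipschitz, is bounded along the
  iterates.
\<close>
lemma weak_cluster_point_in_VI_SOL:
  fixes C :: "'a::{real_inner, complete_space} set"
  assumes C: "closed C" "convex C" and mono: "monotone_operator F" and lip: "L-lipschitz_on UNIV F"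
    and yC: "\<And>k. y k \<in> C" and bnd: "\<And>k. norm (x k) \<le> M"
    and b: "0 < bmin" "\<And>k. bmin \<le> b k"
    and res: "\<And>k z. z \<in> C \<Longrightarrow> inner (r k) (z - y k) \<le> b k * inner (F (x k)) (z - y k)"
    and "G \<noteq> bot" and xy: "((\<lambda>k. norm (x k - y k)) \<longlongrightarrow> 0) G" and r: "((\<lambda>k. norm (r k)) \<longlongrightarrow> 0) G"
    and lim: "\<And>z. ((\<lambda>k. inner (x k) z) \<longlongrightarrow> inner q z) G"
  shows "q \<in> VI_SOL C F"
proof (rule minty)
  show "continuous_on UNIV F" using lip by (rule lipschitz_on_continuous_on)
  have "((\<lambda>k. inner (x k - y k) z) \<longlongrightarrow> 0) G" for z
    using tendsto_inner[OF tendsto_norm_zero_cancel[OF xy] tendsto_const[of z]] by simp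
  then have "((\<lambda>k. inner (y k) z) \<longlongrightarrow> inner q z) G" for z
    using tendsto_diff[OF lim[of z], of "\<lambda>k. inner (x k - y k) z" 0] by (simp add: inner_diff_left)
  then show "q \<in> C" by (rule weak_limit_in_convex[of C y G q, OF C yC \<open>G \<noteq> bot\<close>])
  fix z assume z: "z \<in> C"
  define K where "K = norm (F 0) + L * M"
  have FK: "norm (F (x k)) \<le> K" for k
  proof -
    have "norm (F (x k) - F 0) \<le> L * norm (x k)"
      using lipschitz_onD[OF lip, of "x k" 0] by (simp add: dist_norm)
    also have "\<dots> \<le> L * M" using bnd lipschitz_on_nonneg[OF lip] by (intro mult_left_mono) auto
    finally show ?thesis using norm_triangle_ineq[of "F (x k) - F 0" "F 0"] by (simp add: K_def)
  qed
  \<comment> \<open>the lower bound left by the two errors, from the residual and from replacing \<open>y k\<close> by \<open>x k\<close>\<close>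
  define lb where "lb k = - (norm (r k) * (norm z + M + norm (x k - y k)) / bmin) - K * norm (x k - y k)" for k
  show "0 \<le> inner (F z) (z - q)"
  proof (rule tendsto_le[OF \<open>G \<noteq> bot\<close>])
    show "((\<lambda>k. inner (F z) (z - x k)) \<longlongrightarrow> inner (F z) (z - q)) G"
      using tendsto_diff[OF tendsto_const[of "inner (F z) z"] lim[of "F z"]]
      by (simp add: inner_diff_right inner_commute)
    have "(lb \<longlongrightarrow> - (0 * (norm z + M + 0) / bmin) - K * 0) G"
      unfolding lb_def by (intro tendsto_intros xy r) (use b in simp)
    then show "(lb \<longlongrightarrow> 0) G" by simp
    have "lb k \<le> inner (F z) (z - x k)" for k
    proof -
      define s where "s = norm (r k) * (norm z + M + norm (x k - y k))"
      have s0: "0 \<le> s" unfolding s_def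
        using order_trans[OF norm_ge_zero bnd[of k]] by simp
      have "norm (z - y k) \<le> norm z + M + norm (x k - y k)"
        using norm_triangle_ineq4[of z "x k"] norm_triangle_ineq[of "z - x k" "x k - y k"] bnd[of k]
        by simp
      then have "norm (r k) * norm (z - y k) \<le> s"
        unfolding s_def by (intro mult_left_mono) auto
      then have "- s \<le> inner (r k) (z - y k)"
        using Cauchy_Schwarz_ineq2[of "r k" "z - y k"] by linarith
      then have *: "- s \<le> b k * inner (F (x k)) (z - y k)" using res[OF z, of k] by linarith
      have bk: "0 < b k" using b(1) b(2)[of k] by linarith
      have "- (s / bmin) \<le> - (s / b k)"
        using divide_left_mono[OF b(2)[of k] s0] b(1) bk by simp
      also have "\<dots> \<le> inner (F (x k)) (z - y k)"
        using * bk by (simp add: field_simps)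
      finally have 1: "- (s / bmin) \<le> inner (F (x k)) (z - y k)" .
      have "inner (F (x k)) (x k - y k) \<le> K * norm (x k - y k)"
        using Cauchy_Schwarz_ineq2[of "F (x k)" "x k - y k"]
          mult_right_mono[OF FK[of k] norm_ge_zero[of "x k - y k"]] by linarith
      with 1 have "lb k \<le> inner (F (x k)) (z - y k) - inner (F (x k)) (x k - y k)"
        by (simp add: lb_def s_def)
      also have "\<dots> = inner (F (x k)) (z - x k)" by (simp add: inner_simps)
      also have "\<dots> \<le> inner (F z) (z - x k)"
        using mono[unfolded monotone_operator_def, rule_format, of z "x k"]
        by (simp add: inner_diff_left)
      finally show ?thesis .
    qed
    then show "\<forall>\<^sub>F k in G. lb k \<le> inner (F z) (z - x k)" by simp
  qed
qed (fact C)

section \<open>One step of the algorithm\<close>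

lemma iPC_d_bounds:
  fixes F :: "'a::real_inner \<Rightarrow> 'a"
  assumes b: "0 \<le> b" "b * norm (F x - F y) \<le> \<nu> * norm (x - y)"
    and a1: "0 \<le> a1" "a1 * norm (x - x') \<le> \<mu> * norm (x - y)"
  shows iPC_d_inner_lower: "(1 - \<nu> - \<mu>) * (norm (x - y))\<^sup>2 \<le> inner (x - y) (iPC_d F b a1 x' x y)"
    and iPC_d_norm_upper: "norm (iPC_d F b a1 x' x y) \<le> (1 + \<nu> + \<mu>) * norm (x - y)"
proof -
  let ?n = "norm (x - y)" and ?f = "b *\<^sub>R (F x - F y)" and ?e = "a1 *\<^sub>R (x - x')"
  have f: "norm ?f \<le> \<nu> * ?n" and e: "norm ?e \<le> \<mu> * ?n" using assms by simp_all
  have "inner (x - y) ?f \<le> ?n * (\<nu> * ?n)"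
    using norm_cauchy_schwarz[of "x - y" ?f] mult_left_mono[OF f, of ?n] by simp
  moreover have "- (?n * (\<mu> * ?n)) \<le> inner (x - y) ?e"
    using Cauchy_Schwarz_ineq2[of "x - y" ?e] mult_left_mono[OF e norm_ge_zero[of "x - y"]]
    by linarith
  moreover have "inner (x - y) (iPC_d F b a1 x' x y) = ?n\<^sup>2 - inner (x - y) ?f + inner (x - y) ?e"
    unfolding iPC_d_def by (simp only: inner_diff_right[of "x - y" "x - y" ?f] inner_add_right power2_norm_eq_inner)
  ultimately show "(1 - \<nu> - \<mu>) * ?n\<^sup>2 \<le> inner (x - y) (iPC_d F b a1 x' x y)"
    by (simp add: algebra_simps power2_eq_square)
  have "norm (iPC_d F b a1 x' x y) \<le> ?n + norm ?f + norm ?e"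
    unfolding iPC_d_def using norm_triangle_ineq norm_triangle_ineq4 by (meson add_mono order.trans order_refl)
  with f e show "norm (iPC_d F b a1 x' x y) \<le> (1 + \<nu> + \<mu>) * ?n"
    by (simp add: algebra_simps)
qed

text \<open>
  The gain equals \<open>\<langle>x - y, d\<rangle>\<^sup>2 / \<parallel>d\<parallel>\<^sup>2\<close>: the numerator is at least of order
  \<open>\<parallel>x - y\<parallel>\<^sup>4\<close> and the denominator at most of order \<open>\<parallel>x - y\<parallel>\<^sup>2\<close>.
\<close>
lemma iPC_gain_lower:
  fixes F :: "'a::real_inner \<Rightarrow> 'a"
  assumes b: "0 \<le> b" "b * norm (F x - F y) \<le> \<nu> * norm (x - y)"
    and a1: "0 \<le> a1" "a1 * norm (x - x') \<le> \<mu> * norm (x - y)"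
    and d: "iPC_d F b a1 x' x y \<noteq> 0" and "0 \<le> \<nu>" "0 \<le> \<mu>" "\<mu> < 1 - \<nu>"
  shows "((1 - \<nu> - \<mu>) / (1 + \<nu> + \<mu>))\<^sup>2 * (norm (x - y))\<^sup>2
    \<le> iPC_rho F b a1 x' x y * inner (x - y) (iPC_d F b a1 x' x y)"
proof -
  define d' where "d' = iPC_d F b a1 x' x y"
  define c C n I where "c = 1 - \<nu> - \<mu>" and "C = 1 + \<nu> + \<mu>" and "n = norm (x - y)" and "I = inner (x - y) d'"
  have pos: "0 < c" "0 < C" "0 < norm d'" "0 \<le> n" using assms by (auto simp: c_def C_def d'_def n_def)
  have I: "c * n\<^sup>2 \<le> I" and N: "norm d' \<le> C * n"
    using iPC_d_bounds[OF b a1] by (simp_all add: c_def C_def d'_def n_def I_def)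
  have "(c * n * norm d')\<^sup>2 \<le> (c * n * (C * n))\<^sup>2"
    using pos N by (intro power_mono mult_left_mono) auto
  also have "\<dots> = C\<^sup>2 * (c * n\<^sup>2)\<^sup>2" by (simp add: power2_eq_square)
  also have "\<dots> \<le> C\<^sup>2 * I\<^sup>2" using pos I by (intro mult_left_mono power_mono) auto
  finally have "(c / C)\<^sup>2 * n\<^sup>2 \<le> I\<^sup>2 / (norm d')\<^sup>2"
    using pos by (simp add: field_simps power_mult_distrib)
  also have "\<dots> = iPC_rho F b a1 x' x y * I"
    by (simp add: iPC_rho_def d'_def I_def power2_eq_square)
  finally show ?thesis by (simp add: c_def C_def n_def I_def d'_def)
qed

text \<open>
  Both inequalities are the obtuse-angle property of the predictor projection, since the
  projected point minus \<open>y\<close> equals \<open>x - y + a1 (x - x') - b F x\<close> and also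
  \<open>d - b F y\<close>. The first form is used to identify cluster points, the second in the Fejer
  estimate, where the corrector moves along \<open>F y\<close>.
\<close>
lemma iPC_II_predictor:
  fixes C :: "'a::{real_inner, complete_space} set"
  assumes C: "C \<noteq> {}" "closed C" "convex C"
    and step: "iPC_II_step C F \<nu> \<gamma> b a1 a2 x' x y xn"
  shows "y \<in> C"
    and "z \<in> C \<Longrightarrow> inner (x - y + a1 *\<^sub>R (x - x')) (z - y) \<le> b * inner (F x) (z - y)"
    and "z \<in> C \<Longrightarrow> inner (iPC_d F b a1 x' x y) (z - y) \<le> b * inner (F y) (z - y)"
proof -
  have y: "y = metric_proj C (x - b *\<^sub>R F x + a1 *\<^sub>R (x - x'))"
    using step by (simp add: iPC_II_step_def)
  show "y \<in> C" using metric_proj_in[OF C] y by simp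
  assume "z \<in> C"
  from metric_proj_obtuse[OF C this, of "x - b *\<^sub>R F x + a1 *\<^sub>R (x - x')", folded y]
  show 1: "inner (x - y + a1 *\<^sub>R (x - x')) (z - y) \<le> b * inner (F x) (z - y)"
    by (simp add: inner_add_left inner_diff_left)
  then show "inner (iPC_d F b a1 x' x y) (z - y) \<le> b * inner (F y) (z - y)"
    by (simp add: iPC_d_def inner_add_left inner_diff_left right_diff_distrib)
qed

text \<open>
  The corrector projection bounds \<open>\<langle>xn - x, xn - p\<rangle>\<close> in terms of \<open>b \<langle>F y, xn - p\<rangle>\<close>. By
  monotonicity at the solution \<open>p\<close>, this is at least \<open>b \<langle>F y, xn - y\<rangle>\<close>, and by the predictor at
  least \<open>\<langle>d, xn - y\<rangle>\<close>. Splitting \<open>xn - y = (xn - x) + (x - y)\<close>, the part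
  \<open>\<langle>d, xn - x\<rangle>\<close> is absorbed by completing the square, and the definition of \<open>\<rho>\<close> is exactly what
  gives \<open>\<rho>\<^sup>2 \<parallel>d\<parallel>\<^sup>2 = \<rho> \<langle>x - y, d\<rangle>\<close>, so that the factor \<open>\<gamma> (2 - \<gamma>)\<close> appears.
\<close>
lemma iPC_II_fejer_step:
  fixes C :: "'a::{real_inner, complete_space} set"
  assumes C: "C \<noteq> {}" "closed C" "convex C" and mono: "monotone_operator F"
    and p: "p \<in> VI_SOL C F" and "0 \<le> \<gamma>"
    and rho: "0 \<le> iPC_rho F b a1 x' x y"
    and step: "iPC_II_step C F \<nu> \<gamma> b a1 a2 x' x y xn"
  shows "(norm (xn - p))\<^sup>2 \<le> (norm (x - p))\<^sup>2
      - \<gamma> * (2 - \<gamma>) * (iPC_rho F b a1 x' x y * inner (x - y) (iPC_d F b a1 x' x y))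
      + 2 * norm (a2 *\<^sub>R (x - x')) * norm (xn - p)"
proof -
  define d \<rho> e where "d = iPC_d F b a1 x' x y" and "\<rho> = iPC_rho F b a1 x' x y" and "e = a2 *\<^sub>R (x - x')"
  have pC: "p \<in> C" and pF: "\<And>z. z \<in> C \<Longrightarrow> 0 \<le> inner (F p) (z - p)"
    using p by (auto simp: VI_SOL_def)
  have b: "0 < b" and d0: "d \<noteq> 0" and xn: "xn = metric_proj C (x - (\<gamma> * b * \<rho>) *\<^sub>R F y + e)"
    using step unfolding iPC_II_step_def d_def \<rho>_def e_def by blast+
  note pred = iPC_II_predictor[OF C step, folded d_def]
  have xnC: "xn \<in> C" using metric_proj_in[OF C] xn by simp
  have "0 \<le> inner (F y) (y - p)"
    using mono[unfolded monotone_operator_def, rule_format, of y p] pF[OF pred(1)]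
    by (simp add: inner_diff_left)
  then have "inner d (xn - y) \<le> b * inner (F y) (xn - y) + b * inner (F y) (y - p)"
    using pred(3)[OF xnC] b by (simp add: add_increasing2)
  also have "\<dots> = b * inner (F y) (xn - p)" by (simp add: inner_diff_right algebra_simps)
  finally have "\<gamma> * \<rho> * inner d (xn - y) \<le> \<gamma> * \<rho> * (b * inner (F y) (xn - p))"
    using \<open>0 \<le> \<gamma>\<close> rho by (intro mult_left_mono) (simp_all add: \<rho>_def)
  moreover have "inner (x - (\<gamma> * b * \<rho>) *\<^sub>R F y + e - xn) (p - xn) \<le> 0"
    using metric_proj_obtuse[OF C pC] xn by metis
  then have "inner (xn - x) (xn - p) \<le> inner e (xn - p) - \<gamma> * \<rho> * (b * inner (F y) (xn - p))"
    by (simp add: inner_simps algebra_simps)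
  ultimately have 1: "inner (xn - x) (xn - p) \<le> inner e (xn - p) - \<gamma> * \<rho> * inner d (xn - y)"
    by linarith
  have \<rho>d: "\<rho>\<^sup>2 * (norm d)\<^sup>2 = \<rho> * inner (x - y) d"
    using d0 by (simp add: \<rho>_def iPC_rho_def d_def power2_eq_square)
  have "0 \<le> (norm (xn - x + (\<gamma> * \<rho>) *\<^sub>R d))\<^sup>2" by simp
  also have "\<dots> = (norm (xn - x))\<^sup>2 + 2 * (\<gamma> * \<rho>) * inner d (xn - x) + \<gamma>\<^sup>2 * (\<rho>\<^sup>2 * (norm d)\<^sup>2)"
    by (simp only: power2_norm_eq_inner inner_add_left inner_add_right inner_scaleR_left
        inner_scaleR_right inner_commute[of "xn - x" d]) (simp add: power2_eq_square algebra_simps)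
  finally have 2: "0 \<le> (norm (xn - x))\<^sup>2 + 2 * (\<gamma> * \<rho>) * inner d (xn - x) + \<gamma>\<^sup>2 * (\<rho> * inner (x - y) d)"
    unfolding \<rho>d .
  have 3: "(norm (xn - p))\<^sup>2 = (norm (x - p))\<^sup>2 - (norm (xn - x))\<^sup>2 + 2 * inner (xn - x) (xn - p)"
    by (simp add: power2_norm_eq_inner inner_simps inner_commute)
  have 4: "\<gamma> * \<rho> * inner d (xn - y) = \<gamma> * \<rho> * inner d (xn - x) + \<gamma> * (\<rho> * inner (x - y) d)"
    by (simp add: inner_simps inner_commute algebra_simps)
  have 5: "inner e (xn - p) \<le> norm e * norm (xn - p)" by (rule norm_cauchy_schwarz)
  have "(norm (xn - p))\<^sup>2 \<le> (norm (x - p))\<^sup>2 - \<gamma> * (2 - \<gamma>) * (\<rho> * inner (x - y) d) + 2 * (norm e * norm (xn - p))"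
    using 1 2 4 5 unfolding 3 by (simp add: algebra_simps power2_eq_square)
  then show ?thesis by (simp add: d_def \<rho>_def e_def)
qed

section \<open>Convergence\<close>

text \<open>
  Subtracting the accumulated errors makes the sequence decreasing, and summability keeps it
  bounded below.
\<close>
lemma quasi_fejer_convergent:
  fixes a e :: "nat \<Rightarrow> real"
  assumes "\<And>k. 0 \<le> a k" "\<And>k. 0 \<le> e k" "summable e" and step: "\<And>k. a (Suc k) \<le> a k + e k"
  shows "convergent a"
proof -
  define b where "b n = a n - sum e {..<n}" for n
  have "decseq b" unfolding b_def decseq_Suc_iff using step by (simp add: algebra_simps)
  moreover have "- suminf e \<le> b n" for n
    using sum_le_suminf[OF assms(3), of "{..<n}"] assms(1)[of n] assms(2) by (simp add: b_def)
  ultimately have "convergent b"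
    by (metis decseq_convergent convergentI)
  moreover have "convergent (\<lambda>n. sum e {..<n})"
    using assms(3) by (simp add: summable_iff_convergent)
  ultimately have "convergent (\<lambda>n. b n + sum e {..<n})" by (rule convergent_add)
  then show ?thesis by (simp add: b_def)
qed

text \<open>
  This converts the Fejer estimate for squared distances, whose error term contains the new
  distance \<open>b\<close> itself, into an estimate for the distances with an additive error.
\<close>
lemma le_add_of_square_le:
  fixes a b s :: real
  assumes "0 \<le> a" "0 \<le> s" "b\<^sup>2 \<le> a\<^sup>2 + 2 * s * b"
  shows "b \<le> a + 2 * s"
proof (rule ccontr)
  assume "\<not> b \<le> a + 2 * s"
  then have "a < b - 2 * s" "a \<le> b" "0 < b" using assms by auto
  then have "a * a \<le> a * b" "a * b < (b - 2 * s) * b"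
    using assms(1) by (auto intro: mult_left_mono mult_strict_right_mono)
  with assms(3) show False by (simp add: power2_eq_square algebra_simps)
qed

theorem theorem5p3:
  fixes C :: "'a::{real_inner, complete_space} set"
    and F :: "'a \<Rightarrow> 'a"
    and L \<nu> \<gamma> \<mu> \<beta>min :: real
    and \<alpha>1 \<alpha>2 \<beta> :: "nat \<Rightarrow> real"
    and x :: "int \<Rightarrow> 'a"
    and y :: "nat \<Rightarrow> 'a"
  assumes "C \<noteq> {}" "closed C" "convex C"
    and "VI_SOL C F \<noteq> {}"
    and "monotone_operator F"
    and "L > 0" "L-lipschitz_on UNIV F"
    and "0 < \<nu>" "\<nu> < 1"
    and "0 < \<gamma>" "\<gamma> < 2"
    and "\<And>k. \<alpha>1 k \<in> {0..1}" "\<And>k. \<alpha>2 k \<in> {0..1}"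
    and "iPC_II C F \<nu> \<gamma> \<beta> \<alpha>1 \<alpha>2 x y"
    and "\<beta>min > 0" "\<And>k. \<beta>min \<le> \<beta> k"
    and "summable (\<lambda>k. \<alpha>1 k * norm (x (int k) - x (int k - 1)))"
    and "summable (\<lambda>k. \<alpha>2 k * norm (x (int k) - x (int k - 1)))"
    and "0 \<le> \<mu>" "\<mu> < 1 - \<nu>"
    and "\<And>k. \<alpha>1 k * norm (x (int k) - x (int k - 1)) \<le> \<mu> * norm (x (int k) - y k)"
  shows "\<exists>p \<in> VI_SOL C F. weakly_converges (\<lambda>k. x (int k)) p"
proof (rule opial)
  note C = assms(1-3)
  define u where "u k = x (int k)" for k
  define r where "r k = norm (u k - y k)" for k
  define s where "s k = norm (\<alpha>2 k *\<^sub>R (u k - x (int k - 1)))" for k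
  define w where "w k = iPC_rho F (\<beta> k) (\<alpha>1 k) (x (int k - 1)) (u k) (y k)
    * inner (u k - y k) (iPC_d F (\<beta> k) (\<alpha>1 k) (x (int k - 1)) (u k) (y k))" for k
  define c where "c = ((1 - \<nu> - \<mu>) / (1 + \<nu> + \<mu>))\<^sup>2"
  have step: "iPC_II_step C F \<nu> \<gamma> (\<beta> k) (\<alpha>1 k) (\<alpha>2 k) (x (int k - 1)) (u k) (y k) (u (Suc k))" for k
    using assms(14) unfolding iPC_II_def u_def by (simp add: add.commute)
  have \<alpha>: "0 \<le> \<alpha>1 k" "0 \<le> \<alpha>2 k" for k using assms(12)[of k] assms(13)[of k] by auto
  have \<beta>: "0 \<le> \<beta> k" "\<beta> k * norm (F (u k) - F (y k)) \<le> \<nu> * norm (u k - y k)"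
    and d: "iPC_d F (\<beta> k) (\<alpha>1 k) (x (int k - 1)) (u k) (y k) \<noteq> 0" for k
    using step[of k] unfolding iPC_II_step_def by (blast intro: less_imp_le)+
  have e1: "\<alpha>1 k * norm (u k - x (int k - 1)) \<le> \<mu> * norm (u k - y k)" for k
    using assms(21)[of k] by (simp add: u_def)
  have gain: "c * (r k)\<^sup>2 \<le> w k" for k
    using iPC_gain_lower[OF \<beta> \<alpha>(1) e1 d, of k] assms(8,19,20) by (simp add: c_def r_def w_def)
  have c: "0 < c" using assms(8,19,20) by (simp add: c_def)
  have rho: "0 \<le> iPC_rho F (\<beta> k) (\<alpha>1 k) (x (int k - 1)) (u k) (y k)" for k
    unfolding iPC_rho_def
    using iPC_d_inner_lower[OF \<beta> \<alpha>(1) e1, of k] assms(20)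
    by (intro divide_nonneg_nonneg) (auto intro: order_trans[rotated])
  have \<gamma>: "0 < \<gamma> * (2 - \<gamma>)" using assms(10,11) by simp
  have fejer: "(norm (u (Suc k) - p))\<^sup>2 \<le> (norm (u k - p))\<^sup>2 - \<gamma> * (2 - \<gamma>) * w k
      + 2 * s k * norm (u (Suc k) - p)" if "p \<in> VI_SOL C F" for p k
    using iPC_II_fejer_step[OF C assms(5) that _ rho step] assms(10) by (simp add: w_def s_def)
  have s_sum: "summable s" using assms(18) \<alpha>(2) by (simp add: s_def[abs_def] u_def)
  have s0: "s \<longlonglongrightarrow> 0" using s_sum by (rule summable_LIMSEQ_zero)
  have conv: "convergent (\<lambda>k. norm (u k - p))" if p: "p \<in> VI_SOL C F" for p
  proof (rule quasi_fejer_convergent[where e = "\<lambda>k. 2 * s k"])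
    show "summable (\<lambda>k. 2 * s k)" using s_sum by (rule summable_mult)
    have "0 \<le> w k" for k using gain[of k] c by (meson order_trans zero_le_mult_iff zero_le_power2 less_imp_le)
    then have "(norm (u (Suc k) - p))\<^sup>2 \<le> (norm (u k - p))\<^sup>2 + 2 * s k * norm (u (Suc k) - p)" for k
      using fejer[OF p, of k] mult_nonneg_nonneg[OF less_imp_le[OF \<gamma>], of "w k"] by fastforce
    then show "norm (u (Suc k) - p) \<le> norm (u k - p) + 2 * s k" for k
      by (intro le_add_of_square_le) (auto simp: s_def)
  qed (simp_all add: s_def)
  show "VI_SOL C F \<noteq> {}" by fact
  show "convergent (\<lambda>k. norm (x (int k) - p))" if "p \<in> VI_SOL C F" for p
    using conv[OF that] by (simp add: u_def)
  obtain p where p: "p \<in> VI_SOL C F" using assms(4) by blast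
  then obtain a where a: "(\<lambda>k. norm (u k - p)) \<longlonglongrightarrow> a" using conv convergent_def by blast
  have r0: "r \<longlonglongrightarrow> 0"
  proof -
    \<comment> \<open>the Fejer estimate solved for the gain; it tends to zero because the distances to \<open>p\<close>
      converge\<close>
    define g where "g k = ((norm (u k - p))\<^sup>2 - (norm (u (Suc k) - p))\<^sup>2
      + 2 * s k * norm (u (Suc k) - p)) / (\<gamma> * (2 - \<gamma>) * c)" for k
    have "g \<longlonglongrightarrow> (a\<^sup>2 - a\<^sup>2 + 2 * 0 * a) / (\<gamma> * (2 - \<gamma>) * c)"
      unfolding g_def by (intro tendsto_intros a s0 LIMSEQ_Suc[OF a]) (use \<gamma> c in auto)
    then have g0: "g \<longlonglongrightarrow> 0" by simp
    have le: "(r k)\<^sup>2 \<le> g k" for k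
    proof -
      have "\<gamma> * (2 - \<gamma>) * (c * (r k)\<^sup>2) \<le> \<gamma> * (2 - \<gamma>) * w k"
        using gain \<gamma> by (intro mult_left_mono) auto
      then have "\<gamma> * (2 - \<gamma>) * c * (r k)\<^sup>2 \<le> (norm (u k - p))\<^sup>2 - (norm (u (Suc k) - p))\<^sup>2
          + 2 * s k * norm (u (Suc k) - p)"
        using fejer[OF p, of k] by (simp only: mult.assoc)
      then show ?thesis unfolding g_def using mult_pos_pos[OF \<gamma> c]
        by (simp add: pos_le_divide_eq mult.commute)
    qed
    have "(\<lambda>k. (r k)\<^sup>2) \<longlonglongrightarrow> 0"
      by (rule tendsto_sandwich[OF _ _ tendsto_const g0]) (simp_all add: le)
    from tendsto_real_sqrt[OF this] show ?thesis by (simp add: r_def[abs_def])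
  qed
  obtain M where "\<And>k. norm (norm (u k - p)) \<le> M"
    using convergent_imp_Bseq[OF conv[OF p]] unfolding Bseq_def by blast
  then have bnd: "norm (u k) \<le> M + norm p" for k
    using norm_triangle_ineq[of "u k - p" p] by (simp add: add_increasing2 order_trans)
  \<comment> \<open>the residual of the predictor's variational inequality; the first inertial term is
    controlled by \<open>r\<close> as well\<close>
  define R where "R k = u k - y k + \<alpha>1 k *\<^sub>R (u k - x (int k - 1))" for k
  have le: "norm (R k) \<le> (1 + \<mu>) * r k" for k
    using norm_triangle_ineq[of "u k - y k" "\<alpha>1 k *\<^sub>R (u k - x (int k - 1))"] e1[of k] \<alpha>(1)[of k]
    by (simp add: R_def r_def distrib_right del: scaleR_diff_right)
  have R0: "(\<lambda>k. norm (R k)) \<longlonglongrightarrow> 0"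
    by (rule tendsto_sandwich[OF _ _ tendsto_const tendsto_mult_right_zero[OF r0, of "1 + \<mu>"]]) (simp_all add: le)
  fix G q assume G: "G \<le> sequentially" "G \<noteq> bot"
    and q: "\<And>z. ((\<lambda>k. inner (x (int k)) z) \<longlongrightarrow> inner q z) G"
  show "q \<in> VI_SOL C F"
  proof (rule weak_cluster_point_in_VI_SOL[where x = u and y = y and r = R and b = \<beta> and G = G])
    show "y k \<in> C" for k by (rule iPC_II_predictor(1)[OF C step])
    show "inner (R k) (z - y k) \<le> \<beta> k * inner (F (u k)) (z - y k)" if "z \<in> C" for k z
      unfolding R_def by (rule iPC_II_predictor(2)[OF C step that])
    show "((\<lambda>k. norm (u k - y k)) \<longlongrightarrow> 0) G" using tendsto_mono[OF G(1) r0] by (simp add: r_def[abs_def])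
    show "((\<lambda>k. norm (R k)) \<longlongrightarrow> 0) G" by (rule tendsto_mono[OF G(1) R0])
    show "((\<lambda>k. inner (u k) z) \<longlongrightarrow> inner q z) G" for z using q by (simp add: u_def)
  qed (fact C(2) C(3) assms(5) assms(7) assms(15) assms(16) bnd G(2))+
qed

end
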